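(* Let $U,V\subseteq\mathbb{R}^n$ be linear subspaces with $V\not\subset U$, let $\gamma,\beta>0$ with $\gamma+\beta<1$, and let $$C_{T,\gamma,\beta}:=(1-\gamma-\beta)\,\mathrm{Id}+\beta\,R_VR_U+\gamma\,R_U.$$ For every $x\in\mathbb{R}^n$, $$C_{T,\gamma,\beta}^k(x)\longrightarrow P_{U\cap V}(x)\quad\text{as }k\to\infty,$$ with optimal asymptotic linear rate $$\Gamma(\gamma,\beta):=\max\bigl\{|\lambda|:\lambda\in\sigma(C_{T,\gamma,\beta})\setminus\{1\}\bigr\}<1,$$ where $\sigma(\cdot)$ denotes the (complex) spectrum.
   Context: For a linear subspace $W\subseteq\mathbb{R}^n$, $P_W$ is the orthogonal projection onto $W$ and $R_W=2P_W-\mathrm{Id}$. For a linear operator $L$ on $\mathbb{R}^n$ with $L^k\to L^\infty$, a number $r\in[0,1)$ is a linear convergence rate if there are $m>0$ and $N\in\mathbb{N}$ with $\|L^k-L^\infty\|\le m\,r^k$ for all $k\ge N$; the optimal asymptotic linear rate is the infimum of all such $r$. *)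

theory Defs
  imports "HOL-Analysis.Analysis"
begin

definition orth_proj :: "'a::euclidean_space set \<Rightarrow> 'a \<Rightarrow> 'a" where
  "orth_proj W x = (THE p. p \<in> W \<and> (\<forall>w\<in>W. orthogonal (x - p) w))"

lemma orth_proj:
  assumes "subspace W"
  shows "orth_proj W x \<in> W \<and> (\<forall>w\<in>W. orthogonal (x - orth_proj W x) w)"
  unfolding orth_proj_def
proof (rule theI')
  have W: "span W = W" using assms by (simp add: span_eq_iff)
  obtain y z where yz: "y \<in> span W" "\<And>w. w \<in> span W \<Longrightarrow> orthogonal z w" "x = y + z"
    using orthogonal_subspace_decomp_exists[of W x] by blast
  show "\<exists>!p. p \<in> W \<and> (\<forall>w\<in>W. orthogonal (x - p) w)"
  proof (rule ex1I[of _ y])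
    show "y \<in> W \<and> (\<forall>w\<in>W. orthogonal (x - y) w)"
      using yz W by auto
    fix p assume p: "p \<in> W \<and> (\<forall>w\<in>W. orthogonal (x - p) w)"
    have "y - p \<in> W" using p yz W assms by (auto intro: subspace_diff)
    then have "(x - p) \<bullet> (y - p) = 0" "z \<bullet> (y - p) = 0"
      using p yz W by (auto simp: orthogonal_def)
    then have "(y - p) \<bullet> (y - p) = 0"
      using yz by (simp add: inner_diff_left inner_add_left)
    then show "p = y" by simp
  qed
qed

definition reflector :: "'a::euclidean_space set \<Rightarrow> 'a \<Rightarrow> 'a" where
  "reflector W x = 2 *\<^sub>R orth_proj W x - x"

definition C_op :: "'a::euclidean_space set \<Rightarrow> 'a set \<Rightarrow> real \<Rightarrow> real \<Rightarrow> 'a \<Rightarrow> 'a" where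
  "C_op U V \<gamma> \<beta> x =
     (1 - \<gamma> - \<beta>) *\<^sub>R x + \<beta> *\<^sub>R reflector V (reflector U x) + \<gamma> *\<^sub>R reflector U x"

text \<open>The complex spectrum of a linear operator on a real coordinate space, that is, the
  spectrum of its complexification; meaningful only for linear operators.\<close>

definition complex_spectrum :: "(real^'n \<Rightarrow> real^'n) \<Rightarrow> complex set" where
  "complex_spectrum L =
     {z. \<not> invertible (map_matrix complex_of_real (matrix L) - (mat z :: complex^'n^'n))}"

definition linear_rates :: "('a::euclidean_space \<Rightarrow> 'a) \<Rightarrow> ('a \<Rightarrow> 'a) \<Rightarrow> real set" where
  "linear_rates L Linf =
     {r. 0 \<le> r \<and> r < 1 \<and>
         (\<exists>m>0. \<exists>N::nat. \<forall>k\<ge>N. onorm (\<lambda>x. (L ^^ k) x - Linf x) \<le> m * r ^ k)}"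

text \<open>The set of rates is required to be nonempty because \<^const>\<open>Inf\<close> is unspecified on the
  empty set of reals.\<close>

definition has_optimal_linear_rate ::
    "('a::euclidean_space \<Rightarrow> 'a) \<Rightarrow> ('a \<Rightarrow> 'a) \<Rightarrow> real \<Rightarrow> bool" where
  "has_optimal_linear_rate L Linf \<rho> \<longleftrightarrow>
     linear_rates L Linf \<noteq> {} \<and> Inf (linear_rates L Linf) = \<rho>"

text \<open>Only meaningful when the set is finite and nonempty.\<close>

definition Gamma_rate :: "(real^'n) set \<Rightarrow> (real^'n) set \<Rightarrow> real \<Rightarrow> real \<Rightarrow> real" where
  "Gamma_rate U V \<gamma> \<beta> = Max {cmod z |z. z \<in> complex_spectrum (C_op U V \<gamma> \<beta>) - {1}}"

end

theory Submission
  imports Defs "HOL-Computational_Algebra.Fundamental_Theorem_Algebra"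
begin

text \<open>
  Write \<open>C\<close> for the operator and \<open>P\<close> for the projection onto \<open>U \<inter> V\<close>. Since \<open>C x\<close> is a proper
  convex combination of the three vectors \<open>x\<close>, \<open>R\<^sub>V (R\<^sub>U x)\<close> and \<open>R\<^sub>U x\<close>, all of the same norm,
  strict convexity of the norm gives \<open>\<parallel>C x\<parallel> < \<parallel>x\<parallel>\<close> unless the three coincide, that is, unless
  \<open>x \<in> U \<inter> V\<close> (\<open>C_op_norm_less\<close>). Moreover \<open>C\<close> fixes \<open>U \<inter> V\<close> pointwise and maps its orthogonal
  complement into itself. By compactness of the unit sphere \<open>C\<close> contracts this complement by a
  constant factor below 1, so \<open>C\<^sup>k x = P x + C\<^sup>k (x - P x)\<close> tends to \<open>P x\<close> (\<open>C_op_converges\<close>).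

  The statement about the rate uses nothing else about \<open>C\<close>: for every linear \<open>L\<close> on a real
  coordinate space whose powers converge pointwise to some \<open>P \<noteq> Id\<close>, the optimal rate is the
  largest modulus of an eigenvalue other than 1 (\<open>optimal_rate_subdominant\<close>). After
  complexification, \<open>P\<close> kills the eigenvectors of \<open>L\<close> for eigenvalues \<open>z \<noteq> 1\<close> and fixes those
  for the eigenvalue 1; hence the eigenvalues of \<open>L\<close> on the kernel of \<open>P\<close> are exactly the
  spectrum without 1, and they have modulus below 1 because the powers tend to 0 on them.

  No rate is smaller than the modulus of such a \<open>z\<close>, because \<open>L\<^sup>k - P\<close> multiplies its
  eigenvector by \<open>z\<^sup>k\<close>. Conversely, let \<open>r\<close> exceed all these moduli. The vectors \<open>v\<close> in the kernel
  of \<open>P\<close> with \<open>L\<^sup>k v = O(r\<^sup>k)\<close> form an invariant subspace \<open>T\<close>. If \<open>T\<close> were not the whole kernel,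
  \<open>L\<close> would have an eigenvector modulo \<open>T\<close>: some \<open>w \<notin> T\<close> and \<open>z\<close> with \<open>L w - z w \<in> T\<close>
  (\<open>eigenvector_modulo\<close>). For \<open>|z| < r\<close>, summing a geometric recursion puts \<open>w\<close> in \<open>T\<close>;
  for \<open>|z| \<ge> r\<close> the operator \<open>L - z\<close> is injective on the kernel, so it maps \<open>T\<close> onto \<open>T\<close> and
  again \<open>w \<in> T\<close>. This replaces Gelfand's formula and the Jordan normal form
  (\<open>iterates_growth\<close>).
\<close>

section \<open>Polynomials in a complex operator\<close>

abbreviation complex_linear :: "(complex^'n \<Rightarrow> complex^'n) \<Rightarrow> bool" where
  "complex_linear \<equiv> Vector_Spaces.linear (*s) (*s)"

lemma complex_linearI:
  assumes "\<And>v w. f (v + w) = f v + f w" "\<And>c v. f (c *s v) = c *s f v"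
  shows "complex_linear f"
  using assms by (simp add: Vector_Spaces.linear_iff vec.vector_space_axioms)

lemma complex_linearD:
  assumes "complex_linear f"
  shows "f (v + w) = f v + f w" "f (c *s v) = c *s f v" "f (v - w) = f v - f w" "f 0 = 0"
  using assms vec.linear_add vec.linear_scale vec.linear_diff vec.linear_0 by blast+

lemma complex_linear_funpow: "complex_linear f \<Longrightarrow> complex_linear (f ^^ k)"
  by (induction k) (auto intro!: complex_linearI simp: complex_linearD)

text \<open>The vector \<open>p(f) v\<close>, by Horner's scheme.\<close>

definition poly_apply ::
    "(complex^'n \<Rightarrow> complex^'n) \<Rightarrow> complex poly \<Rightarrow> complex^'n \<Rightarrow> complex^'n" where
  "poly_apply f p v = fold_coeffs (\<lambda>a w. a *s v + f w) p 0"

lemma poly_apply_0 [simp]: "poly_apply f 0 v = 0"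
  by (simp add: poly_apply_def)

lemma poly_apply_pCons:
  assumes "complex_linear f"
  shows "poly_apply f (pCons a p) v = a *s v + f (poly_apply f p v)"
proof (cases "a = 0 \<and> p = 0")
  case True
  then show ?thesis by (simp add: complex_linearD[OF assms])
next
  case False
  then show ?thesis
    unfolding poly_apply_def by (cases "a = 0") auto
qed

context
  fixes f :: "complex^'n \<Rightarrow> complex^'n"
  assumes f: "complex_linear f"
begin

lemmas poly_apply_rules = poly_apply_pCons[OF f] complex_linearD[OF f] algebra_simps

lemma poly_apply_add: "poly_apply f (p + q) v = poly_apply f p v + poly_apply f q v"
  by (induction p q rule: poly_induct2) (simp_all add: poly_apply_rules)

lemma poly_apply_smult: "poly_apply f (smult c p) v = c *s poly_apply f p v"
  by (induction p) (simp_all add: poly_apply_rules)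

lemma poly_apply_diff: "poly_apply f (p - q) v = poly_apply f p v - poly_apply f q v"
  using poly_apply_add[of "p - q" q v] by (simp add: algebra_simps)

lemma poly_apply_mult: "poly_apply f (p * q) v = poly_apply f p (poly_apply f q v)"
  by (induction p) (simp_all add: poly_apply_rules poly_apply_add poly_apply_smult)

lemma poly_apply_monom: "poly_apply f (monom 1 k) v = (f ^^ k) v"
  by (induction k) (simp_all add: poly_apply_rules monom_Suc monom_0)

lemma poly_apply_linear: "complex_linear (poly_apply f p)"
proof -
  have "poly_apply f p (v + w) = poly_apply f p v + poly_apply f p w" for v w
    by (induction p) (simp_all add: poly_apply_rules)
  moreover have "poly_apply f p (c *s v) = c *s poly_apply f p v" for c v
    by (induction p) (simp_all add: poly_apply_rules)
  ultimately show ?thesis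
    by (intro complex_linearI) auto
qed

lemma poly_apply_eigenvector:
  assumes "f v = z *s v"
  shows "poly_apply f p v = poly p z *s v"
  using assms by (induction p) (simp_all add: poly_apply_rules)

text \<open>Otherwise each iterate would raise the dimension of the span by one, beyond the
  dimension of the space.\<close>

lemma exists_iterate_in_span: "\<exists>k. (f ^^ k) v \<in> vec.span ((\<lambda>i. (f ^^ i) v) ` {..<k})"
proof (rule ccontr)
  assume *: "\<not> ?thesis"
  have "vec.dim ((\<lambda>i. (f ^^ i) v) ` {..<k}) = k" for k
  proof (induction k)
    case (Suc k)
    then show ?case using * by (simp add: lessThan_Suc vec.dim_insert)
  qed simp
  then show False
    using dim_subset_UNIV_cart_gen[of "(\<lambda>i. (f ^^ i) v) ` {..<Suc CARD('n)}"]
    by simp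
qed

text \<open>The vanishing \<open>k\<close>-th coefficient makes \<open>X\<^sup>k - p\<close> nonzero; this polynomial annihilates \<open>v\<close>
  when \<open>w\<close> is the \<open>k\<close>-th iterate.\<close>

lemma span_iterates_poly_apply:
  assumes "w \<in> vec.span ((\<lambda>i. (f ^^ i) v) ` {..<k})"
  shows "\<exists>p. coeff p k = 0 \<and> w = poly_apply f p v"
  using assms
proof (induction rule: vec.span_induct_alt)
  case base
  show ?case by (rule exI[of _ 0]) simp
next
  case (step c x y)
  then obtain i p where "i < k" "x = (f ^^ i) v" "coeff p k = 0" "y = poly_apply f p v"
    by auto
  then show ?case
    by (intro exI[of _ "smult c (monom 1 i) + p"])
      (simp add: poly_apply_add poly_apply_smult poly_apply_monom)
qed

lemma exists_vector_annihilator: "\<exists>p. p \<noteq> 0 \<and> poly_apply f p v = 0"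
proof -
  obtain k p where kp: "coeff p k = 0" "(f ^^ k) v = poly_apply f p v"
    using exists_iterate_in_span span_iterates_poly_apply by blast
  have "coeff (monom 1 k - p) k = 1" using kp by simp
  then have "monom 1 k - p \<noteq> 0" by (metis coeff_0 zero_neq_one)
  then show ?thesis
    using kp by (intro exI[of _ "monom 1 k - p"]) (simp add: poly_apply_diff poly_apply_monom)
qed

text \<open>Multiply the annihilators of the basis vectors; the factors commute, so the product
  kills every basis vector.\<close>

lemma exists_annihilator: "\<exists>p. p \<noteq> 0 \<and> (\<forall>v. poly_apply f p v = 0)"
proof -
  have "\<exists>p. p \<noteq> 0 \<and> (\<forall>b\<in>B. poly_apply f p b = 0)" if "finite B" for B
    using that
  proof (induction B)
    case empty
    show ?case by (rule exI[of _ 1]) simp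
  next
    case (insert b B)
    obtain p q where "p \<noteq> 0" "\<forall>b\<in>B. poly_apply f p b = 0" "q \<noteq> 0" "poly_apply f q b = 0"
      using insert exists_vector_annihilator by metis
    moreover have "poly_apply f (q * p) b = poly_apply f p (poly_apply f q b)"
      by (metis mult.commute poly_apply_mult)
    ultimately show ?case
      by (intro exI[of _ "q * p"])
        (simp add: poly_apply_mult complex_linearD[OF poly_apply_linear])
  qed
  then obtain p where p: "p \<noteq> 0" "\<forall>b\<in>cart_basis. poly_apply f p b = 0"
    using finite_cart_basis by metis
  have "poly_apply f p v = 0" for v
    using vec.linear_eq_0_on_span[OF poly_apply_linear, of cart_basis p v] p span_cart_basis by auto
  then show ?thesis using p by blast
qed

lemma finite_eigenvalues: "finite {z. \<exists>v. v \<noteq> 0 \<and> f v = z *s v}"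
proof -
  obtain p where p: "p \<noteq> 0" "\<And>v. poly_apply f p v = 0"
    using exists_annihilator by blast
  have "{z. \<exists>v. v \<noteq> 0 \<and> f v = z *s v} \<subseteq> {z. poly p z = 0}"
    using poly_apply_eigenvector[of _ _ p] p(2) by auto
  then show ?thesis using poly_roots_finite[OF p(1)] finite_subset by blast
qed

text \<open>An eigenvector in the quotient of \<open>S\<close> by \<open>T\<close>: apply the linear factors of an annihilating
  polynomial to \<open>v\<close> one after another. The process ends at 0, which lies in \<open>T\<close>, so some
  factor \<open>f - z\<close> takes a vector from outside \<open>T\<close> into \<open>T\<close>. With \<open>T = {0}\<close> this is an eigenvector
  in the ordinary sense.\<close>

lemma eigenvector_modulo:
  assumes S: "vec.subspace S" "\<And>w. w \<in> S \<Longrightarrow> f w \<in> S" and T: "0 \<in> T" and v: "v \<in> S - T"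
  shows "\<exists>w z. w \<in> S - T \<and> f w - z *s w \<in> T"
proof -
  have "\<exists>w z. w \<in> S - T \<and> f w - z *s w \<in> T"
    if "degree p = n" "p \<noteq> 0" "poly_apply f p v = 0" "v \<in> S - T"
    for n and p :: "complex poly" and v
    using that
  proof (induction n arbitrary: p v)
    case 0
    obtain c where c: "p = [:c:]" using degree_eq_zeroE[OF 0(1)] .
    then have "v = 0" using 0 by (simp add: poly_apply_rules)
    then show ?case using 0 T by blast
  next
    case (Suc n)
    then have "\<not> constant (poly p)" by (simp add: constant_degree)
    then obtain z where "poly p z = 0"
      using fundamental_theorem_of_algebra by blast
    then have "[:- z, 1:] dvd p" by (simp only: poly_eq_0_iff_dvd)
    then obtain q where q: "p = [:- z, 1:] * q" ..
    have "q \<noteq> 0" using Suc.prems(2) q by auto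
    then have "degree q = n" using Suc.prems(1) unfolding q by (simp add: degree_mult_eq del: mult_pCons_left)
    have "poly_apply f q (f v - z *s v) = 0"
    proof -
      have "f v - z *s v = poly_apply f [:- z, 1:] v" by (simp add: poly_apply_rules)
      then show ?thesis using Suc.prems(3) q by (simp only: mult.commute[of _ q] poly_apply_mult)
    qed
    moreover have "f v - z *s v \<in> S"
      using Suc.prems S by (simp add: vec.subspace_diff vec.subspace_scale)
    ultimately show ?case
      using Suc.IH[of q "f v - z *s v"] Suc.prems(4) \<open>q \<noteq> 0\<close> \<open>degree q = n\<close> by blast
  qed
  then show ?thesis using exists_annihilator v by blast
qed

end

section \<open>Growth of iterates below a spectral bound\<close>

lemma norm_complex_scale: "norm (c *s v) = cmod c * norm (v :: complex^'n)"
  by (simp add: norm_vec_def norm_mult L2_set_right_distrib)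

text \<open>The iterates satisfy \<open>f\<^bsup>k+1\<^esup> v = z f\<^sup>k v + f\<^sup>k (f v - z v)\<close>, a recursion with ratio \<open>|z| < r\<close>
  and a forcing term of order \<open>r\<^sup>k\<close>.\<close>

lemma iterates_growth_step:
  fixes f :: "complex^'n \<Rightarrow> complex^'n"
  assumes f: "complex_linear f" and z: "cmod z < r"
    and b: "\<And>k. norm ((f ^^ k) (f v - z *s v)) \<le> m * r ^ k"
  shows "\<exists>M. \<forall>k. norm ((f ^^ k) v) \<le> M * r ^ k"
proof -
  \<comment> \<open>The second argument makes \<open>M r\<^sup>k\<close> a supersolution of the recursion, the first covers \<open>k = 0\<close>.\<close>
  define M where "M = max (norm v) (m / (r - cmod z))"
  have r: "r > 0" using z norm_ge_zero[of z] by linarith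
  have M: "cmod z * M + m \<le> M * r"
  proof -
    have "m / (r - cmod z) \<le> M" by (simp add: M_def)
    then have "m \<le> M * (r - cmod z)" using z by (simp add: divide_le_eq)
    then show ?thesis by (simp add: algebra_simps)
  qed
  have "norm ((f ^^ k) v) \<le> M * r ^ k" for k
  proof (induction k)
    case 0
    show ?case by (simp add: M_def)
  next
    case (Suc k)
    have "(f ^^ Suc k) v = z *s (f ^^ k) v + (f ^^ k) (f v - z *s v)"
      by (simp add: complex_linearD[OF complex_linear_funpow[OF f]] funpow_swap1)
    then have "norm ((f ^^ Suc k) v) \<le> cmod z * norm ((f ^^ k) v) + m * r ^ k"
      using norm_triangle_ineq[of "z *s (f ^^ k) v" "(f ^^ k) (f v - z *s v)"] b[of k]
      by (simp add: norm_complex_scale)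
    also have "\<dots> \<le> cmod z * (M * r ^ k) + m * r ^ k"
      using Suc by (simp add: mult_left_mono)
    also have "\<dots> = (cmod z * M + m) * r ^ k" by (simp add: algebra_simps)
    also have "\<dots> \<le> (M * r) * r ^ k" using M r by (simp add: mult_right_mono)
    finally show ?case by (simp add: algebra_simps)
  qed
  then show ?thesis by blast
qed

text \<open>The upper half of Gelfand's formula on an invariant subspace: if all eigenvalues there have
  modulus below \<open>r\<close>, then the iterates are \<open>O(r\<^sup>k)\<close>. The vectors with this growth form an invariant
  subspace \<open>T\<close>, and an eigenvector modulo \<open>T\<close> cannot exist outside \<open>T\<close>.\<close>

lemma iterates_growth:
  fixes f :: "complex^'n \<Rightarrow> complex^'n"
  assumes f: "complex_linear f"
    and S: "vec.subspace S" "\<And>w. w \<in> S \<Longrightarrow> f w \<in> S"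
    and r: "r > 0" and ev: "\<And>z w. w \<in> S \<Longrightarrow> w \<noteq> 0 \<Longrightarrow> f w = z *s w \<Longrightarrow> cmod z < r"
    and v: "v \<in> S"
  shows "\<exists>m. \<forall>k. norm ((f ^^ k) v) \<le> m * r ^ k"
proof (rule ccontr)
  assume nv: "\<not> ?thesis"
  define T where "T = {w \<in> S. \<exists>m. \<forall>k. norm ((f ^^ k) w) \<le> m * r ^ k}"
  note lin = complex_linearD[OF complex_linear_funpow[OF f]]
  have subT: "vec.subspace T"
  proof (rule vec.subspaceI)
    show "0 \<in> T" using S by (auto simp: T_def lin vec.subspace_0 intro!: exI[of _ 0])
  next
    fix x y assume "x \<in> T" "y \<in> T"
    then obtain m m' where m: "\<And>k. norm ((f ^^ k) x) \<le> m * r ^ k" "\<And>k. norm ((f ^^ k) y) \<le> m' * r ^ k"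
      by (auto simp: T_def)
    have "norm ((f ^^ k) (x + y)) \<le> (m + m') * r ^ k" for k
      using m(1)[of k] m(2)[of k] norm_triangle_ineq[of "(f ^^ k) x" "(f ^^ k) y"]
      by (simp add: lin algebra_simps)
    then show "x + y \<in> T" using \<open>x \<in> T\<close> \<open>y \<in> T\<close> S by (auto simp: T_def vec.subspace_add)
  next
    fix c x assume "x \<in> T"
    then obtain m where m: "\<And>k. norm ((f ^^ k) x) \<le> m * r ^ k" by (auto simp: T_def)
    have "norm ((f ^^ k) (c *s x)) \<le> (cmod c * m) * r ^ k" for k
      using mult_left_mono[OF m[of k], of "cmod c"] by (simp add: lin norm_complex_scale algebra_simps)
    then show "c *s x \<in> T" using \<open>x \<in> T\<close> S by (auto simp: T_def vec.subspace_scale)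
  qed
  have fT: "f w \<in> T" if wT: "w \<in> T" for w
  proof -
    obtain m where m: "\<And>k. norm ((f ^^ k) w) \<le> m * r ^ k" using wT by (auto simp: T_def)
    have "norm ((f ^^ k) (f w)) \<le> (m * r) * r ^ k" for k
      using m[of "Suc k"] by (simp add: funpow_swap1 algebra_simps)
    then show ?thesis using wT S by (auto simp: T_def)
  qed
  obtain w z where w: "w \<in> S - T" "f w - z *s w \<in> T"
    using eigenvector_modulo[OF f S vec.subspace_0[OF subT], of v] nv v by (auto simp: T_def)
  show False
  proof (cases "cmod z < r")
    case True
    obtain m where "\<And>k. norm ((f ^^ k) (f w - z *s w)) \<le> m * r ^ k" using w by (auto simp: T_def)
    then show False using w(1) iterates_growth_step[OF f True, of w m] by (auto simp: T_def)
  next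
    case False
    \<comment> \<open>Here \<open>z\<close> is not an eigenvalue on \<open>S\<close>, so \<open>f - z\<close> is injective there and, by
    dimension, permutes \<open>T\<close>; thus \<open>w\<close> itself is the preimage in \<open>T\<close> of \<open>f w - z w\<close>.\<close>
    define g where "g x = f x - z *s x" for x
    have g: "complex_linear g"
      by (intro complex_linearI)
        (auto simp: g_def complex_linearD[OF f] vec.scale_right_distrib vec.scale_right_diff_distrib mult.commute)
    have ker: "x = 0" if "x \<in> S" "g x = 0" for x
      using ev[of x z] that False by (auto simp: g_def)
    have inj: "inj_on g S"
    proof (rule inj_onI)
      fix x y assume "x \<in> S" "y \<in> S" "g x = g y"
      then show "x = y"
        using ker[of "x - y"] S vec.subspace_diff[of S x y] by (simp add: complex_linearD[OF g])
    qed
    have "T \<subseteq> S" by (auto simp: T_def)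
    have "g ` T = T"
    proof (rule vec.subspace_dim_equal)
      show "vec.subspace (g ` T)" using subT g vec.linear_subspace_image by blast
      show "g ` T \<subseteq> T" using fT subT by (auto simp: g_def vec.subspace_diff vec.subspace_scale)
      have "inj_on g (vec.span T)"
        using inj inj_on_subset \<open>T \<subseteq> S\<close> vec.span_eq_iff[of T] subT by metis
      then show "vec.dim T \<le> vec.dim (g ` T)" using vec.dim_image_eq[OF g] by simp
    qed (rule subT)
    then obtain t where "t \<in> T" "g w = g t" using w(2) by (auto simp: g_def)
    then have "w = t" using inj w(1) \<open>T \<subseteq> S\<close> by (auto dest: inj_onD)
    then show False using w \<open>t \<in> T\<close> by blast
  qed
qed

section \<open>Complexification of a real operator\<close>

definition re_vec :: "complex^'n \<Rightarrow> real^'n" where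
  "re_vec v = (\<chi> i. Re (v $ i))"

definition im_vec :: "complex^'n \<Rightarrow> real^'n" where
  "im_vec v = (\<chi> i. Im (v $ i))"

definition of_real_vec :: "real^'n \<Rightarrow> complex^'n" where
  "of_real_vec x = (\<chi> i. complex_of_real (x $ i))"

text \<open>The complexification acts on real and imaginary parts separately, so that identities
  between real operators carry over by comparing these parts.\<close>

definition complexify :: "(real^'n \<Rightarrow> real^'n) \<Rightarrow> complex^'n \<Rightarrow> complex^'n" where
  "complexify L v = (\<chi> i. Complex (L (re_vec v) $ i) (L (im_vec v) $ i))"

lemma complex_vec_eq_iff: "v = w \<longleftrightarrow> re_vec v = re_vec w \<and> im_vec v = im_vec w"
  by (auto simp: vec_eq_iff re_vec_def im_vec_def complex_eq_iff)

lemma re_im_vec_simps [simp]: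
  "re_vec 0 = 0" "im_vec 0 = 0"
  "re_vec (v + w) = re_vec v + re_vec w" "im_vec (v + w) = im_vec v + im_vec w"
  "re_vec (v - w) = re_vec v - re_vec w" "im_vec (v - w) = im_vec v - im_vec w"
  "re_vec (c *s v) = Re c *\<^sub>R re_vec v - Im c *\<^sub>R im_vec v"
  "im_vec (c *s v) = Re c *\<^sub>R im_vec v + Im c *\<^sub>R re_vec v"
  "re_vec (complexify L v) = L (re_vec v)" "im_vec (complexify L v) = L (im_vec v)"
  "re_vec (of_real_vec x) = x" "im_vec (of_real_vec x) = 0"
  by (simp_all add: vec_eq_iff of_real_vec_def re_vec_def im_vec_def complexify_def)

lemma complex_linear_complexify:
  assumes "linear L"
  shows "complex_linear (complexify L)"
  by (rule complex_linearI)
    (simp_all add: complex_vec_eq_iff linear_add[OF assms] linear_diff[OF assms]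
      linear_scale[OF assms])

lemma complexify_funpow: "complexify L ^^ k = complexify (L ^^ k)"
  by (induction k) (simp_all add: fun_eq_iff complex_vec_eq_iff)

lemma complexify_matrix:
  assumes "linear L"
  shows "map_matrix complex_of_real (matrix L) *v v = complexify L v"
proof -
  define A where "A = matrix L"
  have L: "L x = A *v x" for x
    unfolding A_def using assms by (simp add: matrix_works)
  show ?thesis
    unfolding complexify_def L A_def[symmetric]
    by (simp add: vec_eq_iff matrix_vector_mult_def re_vec_def im_vec_def complex_eq_iff)
qed

lemma norm_complexify_le: "norm (complexify L v) \<le> norm (L (re_vec v)) + norm (L (im_vec v))"
proof -
  define w where "w = complexify L v"
  have "norm w \<le> norm (re_vec w) + norm (im_vec w)"
  proof -
    have "norm w \<le> L2_set (\<lambda>i. \<bar>Re (w $ i)\<bar> + \<bar>Im (w $ i)\<bar>) UNIV"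
      unfolding norm_vec_def by (intro L2_set_mono cmod_le) auto
    also have "\<dots> \<le> norm (re_vec w) + norm (im_vec w)"
      unfolding norm_vec_def re_vec_def im_vec_def using L2_set_triangle_ineq by fastforce
    finally show ?thesis .
  qed
  then show ?thesis by (simp add: w_def)
qed

lemma norm_re_vec_le: "norm (re_vec v) \<le> norm v" and norm_im_vec_le: "norm (im_vec v) \<le> norm v"
  by (rule norm_le_componentwise_cart;
      simp add: re_vec_def im_vec_def abs_Re_le_cmod abs_Im_le_cmod)+

lemma tendsto_complexify:
  assumes "\<And>x. (\<lambda>k. M k x) \<longlonglongrightarrow> P x"
  shows "(\<lambda>k. complexify (M k) v) \<longlonglongrightarrow> complexify P v"
  unfolding complexify_def by (intro vec_tendstoI) (auto intro!: tendsto_Complex tendsto_vec_nth assms)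

lemma complex_spectrum_eigenvalue:
  assumes "linear L"
  shows "z \<in> complex_spectrum L \<longleftrightarrow> (\<exists>v. v \<noteq> 0 \<and> complexify L v = z *s v)"
proof -
  have "mat z *v v = z *s v" for v :: "complex^'n"
    by (simp add: vec_eq_iff matrix_vector_mult_def mat_def if_distrib [where f = "\<lambda>x. x * _"]
        cong: if_cong)
  then have "(map_matrix complex_of_real (matrix L) - mat z) *v v = complexify L v - z *s v" for v
    using assms by (simp add: matrix_vector_mult_diff_rdistrib complexify_matrix)
  then show ?thesis
    unfolding complex_spectrum_def
    by (auto simp: invertible_left_inverse matrix_left_invertible_ker)
qed

section \<open>The optimal rate of convergent powers\<close>

lemma linear_funpow:
  fixes L :: "'a::real_vector \<Rightarrow> 'a"
  assumes "linear L"
  shows "linear (L ^^ k)"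
proof (induction k)
  case 0
  show ?case by (simp only: funpow.simps id_def linear_ident)
next
  case (Suc k)
  from linear_compose[OF this assms] show ?case by (simp only: funpow.simps)
qed

text \<open>No constant factor makes up for a smaller base. The case \<open>r = 0\<close> is included because 0 may
  be a rate, namely when the powers reach their limit after finitely many steps.\<close>

lemma power_dominates:
  fixes a r M :: real
  assumes "0 \<le> r" "r < a"
  shows "\<exists>k\<ge>N. M * r ^ k < a ^ k"
proof -
  have "(\<lambda>k. M * (r / a) ^ k) \<longlonglongrightarrow> M * 0"
    using assms by (intro tendsto_mult_left LIMSEQ_power_zero) auto
  then have "\<forall>\<^sub>F k in sequentially. M * (r / a) ^ k < 1"
    by (intro order_tendstoD) auto
  then obtain k where k: "k \<ge> N" "M * (r / a) ^ k < 1"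
    unfolding eventually_sequentially using nat_le_linear by blast
  then have "M * r ^ k < a ^ k"
    using assms by (simp add: power_divide field_simps)
  then show ?thesis using k by blast
qed

context
  fixes L P :: "real^'n \<Rightarrow> real^'n"
  assumes L: "linear L" and conv: "\<And>x. (\<lambda>k. (L ^^ k) x) \<longlonglongrightarrow> P x"
begin

lemma linear_iterate: "linear (L ^^ k)"
  using L by (rule linear_funpow)

lemma limit_linear: "linear P"
proof (rule linearI)
  fix x y c
  have "(\<lambda>k. (L ^^ k) x + (L ^^ k) y) \<longlonglongrightarrow> P x + P y" by (intro tendsto_add conv)
  then show "P (x + y) = P x + P y"
    using conv[of "x + y"] LIMSEQ_unique by (simp add: linear_add[OF linear_iterate])
  have "(\<lambda>k. c *\<^sub>R (L ^^ k) x) \<longlonglongrightarrow> c *\<^sub>R P x" by (intro tendsto_scaleR conv tendsto_const)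
  then show "P (c *\<^sub>R x) = c *\<^sub>R P x"
    using conv[of "c *\<^sub>R x"] LIMSEQ_unique by (simp add: linear_scale[OF linear_iterate])
qed

text \<open>The sequences \<open>L\<^sup>k (L x)\<close> and \<open>L (L\<^sup>k x)\<close> are the sequence \<open>L\<^sup>k x\<close> shifted by one, whence
  \<open>P L = P\<close>, \<open>L P = P\<close> and finally \<open>P P = P\<close>.\<close>

lemma limit_absorbs_right: "P (L x) = P x"
proof -
  have "(\<lambda>k. (L ^^ Suc k) x) \<longlonglongrightarrow> P x" using LIMSEQ_Suc[OF conv] .
  then show ?thesis using conv[of "L x"] LIMSEQ_unique by (simp add: funpow_swap1)
qed

lemma limit_fixed: "L (P x) = P x"
proof -
  have "(\<lambda>k. L ((L ^^ k) x)) \<longlonglongrightarrow> L (P x)"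
    using L linear_continuous_at conv isCont_tendsto_compose linear_conv_bounded_linear by metis
  moreover have "(\<lambda>k. L ((L ^^ k) x)) \<longlonglongrightarrow> P x" using LIMSEQ_Suc[OF conv] by simp
  ultimately show ?thesis using LIMSEQ_unique by blast
qed

lemma iterate_limit: "(L ^^ k) (P x) = P x"
  by (induction k) (simp_all add: limit_fixed)

lemma limit_idempotent: "P (P x) = P x"
  using conv[of "P x"] by (simp add: iterate_limit LIMSEQ_const_iff)

lemma iterate_eigenvector:
  assumes "complexify L v = z *s v"
  shows "complexify (L ^^ k) v = z ^ k *s v"
proof (induction k)
  case 0
  show ?case by (simp add: complex_vec_eq_iff)
next
  case (Suc k)
  have "complexify (L ^^ Suc k) v = complexify L (complexify (L ^^ k) v)"
    by (simp add: complex_vec_eq_iff)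
  then show ?case
    by (simp only: Suc) (simp add: assms complex_linearD[OF complex_linear_complexify[OF L]] mult.commute)
qed

lemma limit_fixes_fixed: "complexify P v = v" if "complexify L v = v"
proof -
  have "(\<lambda>k. complexify (L ^^ k) v) \<longlonglongrightarrow> complexify P v"
    by (intro tendsto_complexify conv)
  moreover have "complexify (L ^^ k) v = v" for k
    using iterate_eigenvector[of v 1 k] that by simp
  ultimately show ?thesis by (simp add: LIMSEQ_const_iff)
qed

text \<open>From \<open>P L = P\<close>: \<open>z P v = P (L v) = P v\<close>.\<close>

lemma limit_kills_eigenvector:
  assumes "complexify L v = z *s v" "z \<noteq> 1"
  shows "complexify P v = 0"
proof -
  have "complexify P (complexify L v) = complexify P v"
    by (simp add: complex_vec_eq_iff limit_absorbs_right)
  then have "z *s complexify P v = 1 *s complexify P v"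
    using assms by (simp add: complex_linearD[OF complex_linear_complexify[OF limit_linear]])
  then show ?thesis using assms(2) by (simp only: vec.scale_cancel_right) simp
qed

text \<open>The powers of \<open>L\<close> take the eigenvector \<open>v\<close> to \<open>z\<^sup>k v\<close>, which converges to \<open>P v = 0\<close>.\<close>

lemma eigenvalue_cmod_less_1:
  assumes "z \<in> complex_spectrum L - {1}"
  shows "cmod z < 1"
proof (rule ccontr)
  assume "\<not> ?thesis"
  then have z: "cmod z \<ge> 1" by simp
  obtain v where v: "v \<noteq> 0" "complexify L v = z *s v"
    using assms complex_spectrum_eigenvalue[OF L] by blast
  have "(\<lambda>k. complexify (L ^^ k) v) \<longlonglongrightarrow> 0"
    using tendsto_complexify[where M = "\<lambda>k. L ^^ k", OF conv] limit_kills_eigenvector[OF v(2)] assms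
    by (metis DiffD2 singletonI)
  then have "(\<lambda>k. norm (z ^ k *s v)) \<longlonglongrightarrow> 0"
    using tendsto_norm_zero by (simp add: iterate_eigenvector[OF v(2)])
  moreover have "norm v \<le> norm (z ^ k *s v)" for k
    using z mult_right_mono[of 1 "cmod z ^ k" "norm v"]
    by (simp add: norm_complex_scale norm_power one_le_power)
  ultimately have "norm v \<le> 0" by (intro LIMSEQ_le_const) auto
  then show False using v by simp
qed

text \<open>An eigenvector in the kernel of \<open>P\<close> cannot belong to the eigenvalue 1, because \<open>P\<close> fixes
  the fixed points of \<open>L\<close>.\<close>

lemma kernel_eigenvalue:
  assumes "complexify P v = 0" "v \<noteq> 0" "complexify L v = z *s v"
  shows "z \<in> complex_spectrum L - {1}"
proof -
  have "z \<noteq> 1" using assms limit_fixes_fixed[of v] by auto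
  then show ?thesis using assms complex_spectrum_eigenvalue[OF L] by blast
qed

lemma finite_complex_spectrum: "finite (complex_spectrum L)"
proof -
  have "complex_spectrum L = {z. \<exists>v. v \<noteq> 0 \<and> complexify L v = z *s v}"
    using complex_spectrum_eigenvalue[OF L] by auto
  then show ?thesis using finite_eigenvalues[OF complex_linear_complexify[OF L]] by simp
qed

lemma kernel_subspace: "vec.subspace {v. complexify P v = 0}"
  by (auto intro!: vec.subspaceI simp: complex_linearD[OF complex_linear_complexify[OF limit_linear]])

lemma kernel_invariant: "complexify P (complexify L v) = 0" if "complexify P v = 0"
  using that by (simp add: complex_vec_eq_iff limit_absorbs_right)

text \<open>Via \<open>L\<^sup>k x - P x = L\<^sup>k (x - P x)\<close>, this reduces the approximation error at \<open>x\<close> to the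
  iterates of a vector in the kernel of \<open>P\<close>.\<close>

lemma of_real_vec_in_kernel: "complexify P (of_real_vec (x - P x)) = 0"
  by (simp add: complex_vec_eq_iff linear_diff[OF limit_linear] linear_0[OF limit_linear]
      limit_idempotent)

text \<open>The kernel of \<open>P\<close> is nonzero and invariant, so it contains an eigenvector.\<close>

lemma complex_spectrum_nonempty:
  assumes "P x \<noteq> x"
  shows "complex_spectrum L - {1} \<noteq> {}"
proof -
  let ?v = "of_real_vec (x - P x)"
  have "?v \<noteq> 0" using assms by (auto simp: complex_vec_eq_iff)
  then have "?v \<in> {v. complexify P v = 0} - {0}" using of_real_vec_in_kernel by auto
  then obtain w z where "w \<noteq> 0" "complexify P w = 0" "complexify L w - z *s w = 0"
    using eigenvector_modulo[OF complex_linear_complexify[OF L] kernel_subspace, of "{0}" ?v]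
      kernel_invariant by auto
  then show ?thesis using kernel_eigenvalue[of w z] by auto
qed

text \<open>On the kernel of \<open>P\<close>, the iterates of \<open>L\<close> are \<open>O(r\<^sup>k)\<close> by \<open>iterates_growth\<close>; summing the bounds
  at the basis vectors bounds the operator norm of \<open>L\<^sup>k - P\<close>.\<close>

lemma rate_if_exceeds_spectrum:
  assumes r: "0 < r" "r < 1" and ev: "\<And>z. z \<in> complex_spectrum L - {1} \<Longrightarrow> cmod z < r"
  shows "r \<in> linear_rates L P"
proof -
  have "\<exists>m. \<forall>k. norm ((L ^^ k) x - P x) \<le> m * r ^ k" for x
  proof -
    let ?v = "of_real_vec (x - P x)"
    have "\<exists>m. \<forall>k. norm ((complexify L ^^ k) ?v) \<le> m * r ^ k"
      by (rule iterates_growth[OF complex_linear_complexify[OF L] kernel_subspace])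
        (use kernel_invariant kernel_eigenvalue ev r of_real_vec_in_kernel in auto)
    moreover have "norm ((L ^^ k) x - P x) \<le> norm ((complexify L ^^ k) ?v)" for k
    proof -
      have "re_vec ((complexify L ^^ k) ?v) = (L ^^ k) (x - P x)"
        by (simp add: complexify_funpow)
      also have "\<dots> = (L ^^ k) x - P x"
        by (simp add: linear_diff[OF linear_iterate] iterate_limit)
      finally show ?thesis using norm_re_vec_le by metis
    qed
    ultimately show ?thesis by (blast intro: order_trans)
  qed
  then obtain m where m: "\<And>x k. norm ((L ^^ k) x - P x) \<le> m x * r ^ k" by metis
  have "onorm (\<lambda>x. (L ^^ k) x - P x) \<le> (\<Sum>b\<in>Basis. \<bar>m b\<bar> + 1) * r ^ k" for k
  proof -
    have "bounded_linear (\<lambda>x. (L ^^ k) x - P x)"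
      by (intro bounded_linear_sub) (simp_all add: linear_iterate limit_linear flip: linear_conv_bounded_linear)
    then have "onorm (\<lambda>x. (L ^^ k) x - P x) \<le> (\<Sum>b\<in>Basis. norm ((L ^^ k) b - P b))"
      by (rule onorm_componentwise)
    also have "\<dots> \<le> (\<Sum>b\<in>Basis. (\<bar>m b\<bar> + 1) * r ^ k)"
    proof (rule sum_mono)
      fix b :: "real^'n"
      have "m b * r ^ k \<le> (\<bar>m b\<bar> + 1) * r ^ k" using r by (intro mult_right_mono) auto
      then show "norm ((L ^^ k) b - P b) \<le> (\<bar>m b\<bar> + 1) * r ^ k" using m[of k b] by linarith
    qed
    finally show ?thesis by (simp add: sum_distrib_right)
  qed
  \<comment> \<open>The summand 1 only serves to make the constant positive, as a rate requires.\<close>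
  moreover have "(\<Sum>b\<in>(Basis :: (real^'n) set). \<bar>m b\<bar> + 1) > 0"
    by (intro sum_pos) auto
  ultimately show ?thesis using r unfolding linear_rates_def by auto
qed

text \<open>On an eigenvector \<open>v\<close> for \<open>z\<close> the operator \<open>L\<^sup>k - P\<close> acts as multiplication by \<open>z\<^sup>k\<close>. Passing
  from the real operator norm to complex vectors costs a factor 2, which does not affect the
  exponential rate.\<close>

lemma rate_bounds_spectrum:
  assumes r: "r \<in> linear_rates L P" and z: "z \<in> complex_spectrum L - {1}"
  shows "cmod z \<le> r"
proof (rule ccontr)
  assume "\<not> ?thesis"
  moreover obtain m N where m: "0 \<le> r" "\<And>k. k \<ge> N \<Longrightarrow> onorm (\<lambda>x. (L ^^ k) x - P x) \<le> m * r ^ k"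
    using r by (auto simp: linear_rates_def)
  ultimately obtain k where k: "k \<ge> N" "(2 * m) * r ^ k < cmod z ^ k"
    using power_dominates[of r "cmod z" N "2 * m"] by force
  obtain v where v: "v \<noteq> 0" "complexify L v = z *s v"
    using z complex_spectrum_eigenvalue[OF L] by blast
  define D where "D x = (L ^^ k) x - P x" for x
  have "bounded_linear D" unfolding D_def
    by (intro bounded_linear_sub) (simp_all add: linear_iterate limit_linear flip: linear_conv_bounded_linear)
  then have D: "norm (D x) \<le> (m * r ^ k) * norm x" for x
    using onorm[of D x] m(2)[OF k(1)] mult_right_mono[of "onorm D" "m * r ^ k" "norm x"]
    by (simp add: D_def[abs_def])
  have mr: "m * r ^ k \<ge> 0"
    using m(2)[OF k(1)] onorm_pos_le[OF \<open>bounded_linear D\<close>] by (simp add: D_def[abs_def])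
  have "complexify D v = complexify (L ^^ k) v - complexify P v"
    by (simp add: complex_vec_eq_iff D_def)
  also have "\<dots> = z ^ k *s v"
    using limit_kills_eigenvector[OF v(2)] z by (simp add: iterate_eigenvector[OF v(2)])
  finally have "cmod z ^ k * norm v = norm (complexify D v)"
    by (simp add: norm_complex_scale norm_power)
  also have "\<dots> \<le> (m * r ^ k) * norm (re_vec v) + (m * r ^ k) * norm (im_vec v)"
    using norm_complexify_le[of D v] D[of "re_vec v"] D[of "im_vec v"] by linarith
  also have "\<dots> \<le> (m * r ^ k) * norm v + (m * r ^ k) * norm v"
    using mr norm_re_vec_le norm_im_vec_le by (intro add_mono mult_left_mono) auto
  finally have "cmod z ^ k * norm v \<le> (2 * m * r ^ k) * norm v" by (simp add: algebra_simps)
  then have "cmod z ^ k \<le> 2 * m * r ^ k" using v(1) by simp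
  then show False using k by simp
qed

text \<open>The rates below 1 are all the \<open>r\<close> above \<open>\<rho>\<close> and possibly \<open>\<rho>\<close> itself: the infimum need not be
  attained, since a nontrivial Jordan block for an eigenvalue of modulus \<open>\<rho> > 0\<close> adds a polynomial
  factor to \<open>\<rho>\<^sup>k\<close>.\<close>

theorem optimal_rate_subdominant:
  assumes "P x \<noteq> x"
  defines "\<rho> \<equiv> Max {cmod z |z. z \<in> complex_spectrum L - {1}}"
  shows "has_optimal_linear_rate L P \<rho>" and "\<rho> < 1"
proof -
  let ?M = "{cmod z |z. z \<in> complex_spectrum L - {1}}"
  have M: "?M = cmod ` (complex_spectrum L - {1})" by auto
  have fin: "finite ?M" unfolding M using finite_complex_spectrum by simp
  have ne: "?M \<noteq> {}" unfolding M using complex_spectrum_nonempty[OF assms(1)] by simp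
  have ge: "cmod z \<le> \<rho>" if "z \<in> complex_spectrum L - {1}" for z
    unfolding \<rho>_def using fin that by (intro Max_ge) auto
  obtain z0 where z0: "z0 \<in> complex_spectrum L - {1}" "\<rho> = cmod z0"
    using Max_in[OF fin ne] by (auto simp: \<rho>_def)
  show "\<rho> < 1" using eigenvalue_cmod_less_1 z0 by simp
  have rates: "r \<in> linear_rates L P" if "\<rho> < r" "r < 1" for r
    using rate_if_exceeds_spectrum[of r] ge that z0(2) norm_ge_zero[of z0] by fastforce
  obtain r0 where "\<rho> < r0" "r0 < 1" using dense[OF \<open>\<rho> < 1\<close>] by blast
  then have "linear_rates L P \<noteq> {}" using rates by blast
  moreover have "Inf (linear_rates L P) = \<rho>"
  proof (rule cInf_eq_non_empty)
    show "\<rho> \<le> r" if "r \<in> linear_rates L P" for r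
      using rate_bounds_spectrum[OF that z0(1)] z0(2) by simp
    show "y \<le> \<rho>" if y: "\<And>r. r \<in> linear_rates L P \<Longrightarrow> y \<le> r" for y
    proof (rule ccontr)
      assume "\<not> ?thesis"
      then obtain r where "\<rho> < r" "r < min y 1"
        using dense[of \<rho> "min y 1"] \<open>\<rho> < 1\<close> by auto
      then show False using rates[of r] y[of r] by simp
    qed
  qed fact
  ultimately show "has_optimal_linear_rate L P \<rho>"
    unfolding has_optimal_linear_rate_def by blast
qed

end

section \<open>Orthogonal projections and reflectors\<close>

lemma orth_proj_unique:
  assumes "subspace W" "p \<in> W" "\<And>w. w \<in> W \<Longrightarrow> orthogonal (x - p) w"
  shows "orth_proj W x = p"
proof -
  let ?q = "orth_proj W x"
  have "p - ?q \<in> W" using assms orth_proj subspace_diff by blast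
  then have "(x - ?q) \<bullet> (p - ?q) = 0" "(x - p) \<bullet> (p - ?q) = 0"
    using assms orth_proj[OF assms(1)] by (auto simp: orthogonal_def)
  then have "(p - ?q) \<bullet> (p - ?q) = 0" by (simp add: inner_diff_left)
  then show ?thesis by simp
qed

context
  fixes W :: "'a::euclidean_space set"
  assumes W: "subspace W"
begin

lemma orth_proj_in: "orth_proj W x \<in> W"
  and orth_proj_inner: "w \<in> W \<Longrightarrow> orth_proj W x \<bullet> w = x \<bullet> w"
  using orth_proj[OF W, of x] by (simp_all add: orthogonal_def inner_diff_left)

lemma linear_orth_proj: "linear (orth_proj W)"
proof (rule linearI)
  fix x y c
  show "orth_proj W (x + y) = orth_proj W x + orth_proj W y"
    by (rule orth_proj_unique[OF W])
      (simp_all add: orthogonal_def orth_proj_in orth_proj_inner inner_diff_left inner_add_left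
        subspace_add[OF W])
  show "orth_proj W (c *\<^sub>R x) = c *\<^sub>R orth_proj W x"
    by (rule orth_proj_unique[OF W])
      (simp_all add: orthogonal_def orth_proj_in orth_proj_inner inner_diff_left
        subspace_scale[OF W])
qed

lemma linear_reflector: "linear (reflector W)"
  unfolding reflector_def[abs_def]
  using linear_compose_sub[OF linear_compose_scale_right[OF linear_orth_proj] linear_ident] .

lemma norm_reflector: "norm (reflector W x) = norm x"
proof -
  have "reflector W x \<bullet> reflector W x = x \<bullet> x"
    using orth_proj_inner[OF orth_proj_in, of x x]
    by (simp add: reflector_def inner_diff_left inner_diff_right inner_commute)
  then show ?thesis by (simp add: norm_eq_sqrt_inner)
qed

lemma reflector_eq_self_iff: "reflector W x = x \<longleftrightarrow> x \<in> W"
proof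
  assume "reflector W x = x"
  then have "2 *\<^sub>R orth_proj W x = 2 *\<^sub>R x" by (simp add: reflector_def scaleR_2 algebra_simps)
  then show "x \<in> W" using orth_proj_in[of x] by simp
next
  assume "x \<in> W"
  then have "orth_proj W x = x" by (intro orth_proj_unique[OF W]) (simp_all add: orthogonal_def)
  then show "reflector W x = x" by (simp add: reflector_def scaleR_2)
qed

lemma reflector_inner: "w \<in> W \<Longrightarrow> reflector W x \<bullet> w = x \<bullet> w"
  by (simp add: reflector_def inner_diff_left orth_proj_inner)

end

section \<open>Convergence by strict contraction\<close>

text \<open>Strict convexity of the Hilbert norm, through the variance identity
  \<open>a \<parallel>z - u\<parallel>\<^sup>2 + b \<parallel>z - v\<parallel>\<^sup>2 + c \<parallel>z - w\<parallel>\<^sup>2 = s\<^sup>2 - \<parallel>z\<parallel>\<^sup>2\<close> for the mean \<open>z = a u + b v + c w\<close>.\<close>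

lemma convex_combination_same_norm:
  fixes u v w :: "'a::real_inner"
  assumes pos: "a > 0" "b > 0" "c > 0" "a + b + c = 1"
    and norms: "norm u = s" "norm v = s" "norm w = s"
    and ge: "s \<le> norm (a *\<^sub>R u + b *\<^sub>R v + c *\<^sub>R w)"
  shows "u = v \<and> v = w"
proof -
  define z where "z = a *\<^sub>R u + b *\<^sub>R v + c *\<^sub>R w"
  have sq: "(norm (z - x))\<^sup>2 = z \<bullet> z - 2 * (z \<bullet> x) + s\<^sup>2" if "norm x = s" for x
    using that dot_square_norm[of x]
    by (simp add: power2_norm_eq_inner inner_diff_left inner_diff_right inner_commute)
  have "a * (z \<bullet> u) + b * (z \<bullet> v) + c * (z \<bullet> w) = z \<bullet> z"
    by (simp add: z_def inner_add_right)
  then have "a * (norm (z - u))\<^sup>2 + b * (norm (z - v))\<^sup>2 + c * (norm (z - w))\<^sup>2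
      = (a + b + c) * (z \<bullet> z + s\<^sup>2) - 2 * (z \<bullet> z)"
    by (simp add: sq norms algebra_simps)
  also have "\<dots> = s\<^sup>2 - (norm z)\<^sup>2" by (simp add: pos power2_norm_eq_inner)
  also have "\<dots> \<le> 0"
    using ge norms(1) norm_ge_zero[of u] by (simp add: z_def power_mono)
  finally have le: "a * (norm (z - u))\<^sup>2 + b * (norm (z - v))\<^sup>2 + c * (norm (z - w))\<^sup>2 \<le> 0" .
  have "a * (norm (z - u))\<^sup>2 \<ge> 0" "b * (norm (z - v))\<^sup>2 \<ge> 0" "c * (norm (z - w))\<^sup>2 \<ge> 0"
    using pos by simp_all
  then have "a * (norm (z - u))\<^sup>2 = 0" "b * (norm (z - v))\<^sup>2 = 0" "c * (norm (z - w))\<^sup>2 = 0"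
    using le by linarith+
  then show ?thesis using pos by simp
qed

text \<open>On the compact unit sphere of \<open>W\<close> the norm of \<open>L\<close> attains its supremum, which is therefore
  below 1; by homogeneity it is a uniform contraction factor on \<open>W\<close>.\<close>

lemma strict_contraction_tendsto_0:
  fixes L :: "'a::euclidean_space \<Rightarrow> 'a"
  assumes L: "linear L" and W: "subspace W" and inv: "\<And>x. x \<in> W \<Longrightarrow> L x \<in> W"
    and less: "\<And>x. x \<in> W \<Longrightarrow> x \<noteq> 0 \<Longrightarrow> norm (L x) < norm x" and x: "x \<in> W"
  shows "(\<lambda>k. (L ^^ k) x) \<longlonglongrightarrow> 0"
proof -
  let ?K = "W \<inter> sphere 0 1"
  have "\<exists>q<1. 0 \<le> q \<and> (\<forall>y\<in>?K. norm (L y) \<le> q)"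
  proof (cases "?K = {}")
    case True
    \<comment> \<open>This is the case \<open>W = {0}\<close>, where the supremum over the sphere is empty.\<close>
    then show ?thesis by (intro exI[of _ 0]) auto
  next
    case False
    have "compact ?K" using closed_subspace[OF W] by (intro closed_Int_compact) auto
    moreover have "continuous_on ?K (\<lambda>y. norm (L y))"
      using L by (intro continuous_on_norm linear_continuous_on) (simp add: linear_conv_bounded_linear)
    ultimately obtain y where y: "y \<in> ?K" "\<forall>u\<in>?K. norm (L u) \<le> norm (L y)"
      using continuous_attains_sup[OF _ False] by blast
    then have "norm (L y) < 1" using less[of y] by fastforce
    then show ?thesis using y by (intro exI[of _ "norm (L y)"]) auto
  qed
  then obtain q where q: "0 \<le> q" "q < 1" "\<And>y. y \<in> ?K \<Longrightarrow> norm (L y) \<le> q" by blast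
  have step: "norm (L y) \<le> q * norm y" if "y \<in> W" for y
  proof (cases "y = 0")
    case False
    have "(1 / norm y) *\<^sub>R y \<in> ?K" using False that subspace_scale[OF W] by auto
    from q(3)[OF this] show ?thesis using False by (simp add: linear_scale[OF L] divide_le_eq)
  qed (simp add: linear_0[OF L])
  have bound: "(L ^^ k) x \<in> W \<and> norm ((L ^^ k) x) \<le> q ^ k * norm x" for k
  proof (induction k)
    case (Suc k)
    have "norm (L ((L ^^ k) x)) \<le> q * norm ((L ^^ k) x)" using step Suc by blast
    also have "\<dots> \<le> q * (q ^ k * norm x)" using Suc q by (simp add: mult_left_mono)
    finally show ?case using Suc inv by simp
  qed (use x in simp)
  have lim: "(\<lambda>k. q ^ k * norm x) \<longlonglongrightarrow> 0"
    using q by (intro tendsto_mult_left_zero LIMSEQ_power_zero) simp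
  show ?thesis
    using bound by (intro Lim_null_comparison[OF always_eventually lim]) blast
qed

context
  fixes U V :: "'a::euclidean_space set" and \<gamma> \<beta> :: real
  assumes U: "subspace U" and V: "subspace V"
    and \<gamma>: "\<gamma> > 0" and \<beta>: "\<beta> > 0" and \<gamma>\<beta>: "\<gamma> + \<beta> < 1"
begin

lemma linear_C_op: "linear (C_op U V \<gamma> \<beta>)"
proof -
  have "linear (\<lambda>x. reflector V (reflector U x))"
    using linear_compose[OF linear_reflector[OF U] linear_reflector[OF V]] by (simp add: o_def)
  then show ?thesis
    using linear_reflector[OF U]
    by (simp add: linear_iff C_op_def algebra_simps)
qed

lemma C_op_fixes: "C_op U V \<gamma> \<beta> x = x" if "x \<in> U \<inter> V"
proof -
  have "reflector U x = x" "reflector V x = x"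
    using that reflector_eq_self_iff U V by auto
  then show ?thesis by (simp add: C_op_def flip: scaleR_left_distrib)
qed

text \<open>The three vectors averaged by the operator have the norm of \<open>x\<close>. If the mean has it too, they
  coincide, so both reflectors fix \<open>x\<close>.\<close>

lemma C_op_norm_less: "norm (C_op U V \<gamma> \<beta> x) < norm x" if "x \<notin> U \<inter> V"
proof (rule ccontr)
  assume "\<not> ?thesis"
  then have "x = reflector V (reflector U x) \<and> reflector V (reflector U x) = reflector U x"
    using \<gamma> \<beta> \<gamma>\<beta>
    by (intro convex_combination_same_norm[of "1 - \<gamma> - \<beta>" \<beta> \<gamma> _ "norm x"])
      (auto simp: C_op_def norm_reflector U V)
  then have "reflector U x = x" "reflector V x = x" by auto
  then show False using that reflector_eq_self_iff U V by blast
qed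

text \<open>Reflectors are self-adjoint and fix \<open>U \<inter> V\<close>, so the inner product with a vector of \<open>U \<inter> V\<close> is
  the same before and after a reflection.\<close>

lemma C_op_preserves_complement:
  assumes "\<And>m. m \<in> U \<inter> V \<Longrightarrow> orthogonal m x" and m: "m \<in> U \<inter> V"
  shows "orthogonal m (C_op U V \<gamma> \<beta> x)"
proof -
  have "C_op U V \<gamma> \<beta> x \<bullet> m = 0"
    using assms(1)[OF m] m
    by (simp add: C_op_def inner_add_left reflector_inner U V orthogonal_def inner_commute[of x])
  then show ?thesis by (simp add: orthogonal_def inner_commute)
qed

lemma C_op_converges: "(\<lambda>k. (C_op U V \<gamma> \<beta> ^^ k) x) \<longlonglongrightarrow> orth_proj (U \<inter> V) x"
proof -
  let ?C = "C_op U V \<gamma> \<beta>" and ?p = "orth_proj (U \<inter> V) x"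
  let ?W = "{y. \<forall>m\<in>U \<inter> V. orthogonal m y}"
  have UV: "subspace (U \<inter> V)" using U V by (rule subspace_inter)
  have lim: "(\<lambda>k. (?C ^^ k) (x - ?p)) \<longlonglongrightarrow> 0"
  proof (rule strict_contraction_tendsto_0[of ?C ?W])
    show "linear ?C" by (rule linear_C_op)
    show "subspace ?W" by (rule subspace_orthogonal_to_vectors)
    show "?C y \<in> ?W" if "y \<in> ?W" for y
      using that C_op_preserves_complement by blast
    show "norm (?C y) < norm y" if "y \<in> ?W" "y \<noteq> 0" for y
    proof (rule C_op_norm_less)
      show "y \<notin> U \<inter> V" using that orthogonal_self by blast
    qed
    show "x - ?p \<in> ?W" using orth_proj[OF UV, of x] orthogonal_commute by blast
  qed
  have lin: "linear (?C ^^ k)" for k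
    by (intro linear_funpow linear_C_op)
  have fixed: "(?C ^^ k) ?p = ?p" for k
    using C_op_fixes orth_proj_in[OF UV] by (induction k) auto
  have "(?C ^^ k) x = (?C ^^ k) (x - ?p) + ?p" for k
    by (simp add: linear_diff[OF lin] fixed)
  then show ?thesis using tendsto_add[OF lim tendsto_const[of ?p]] by simp
qed

end

section \<open>Convergence of the powers and their optimal rate\<close>

theorem theorem6p18:
  fixes U V :: "(real^'n) set" and \<gamma> \<beta> :: real
  assumes "subspace U" and "subspace V" and "\<not> V \<subseteq> U"
    and "\<gamma> > 0" and "\<beta> > 0" and "\<gamma> + \<beta> < 1"
  shows "(\<forall>x. (\<lambda>k. (C_op U V \<gamma> \<beta> ^^ k) x) \<longlonglongrightarrow> orth_proj (U \<inter> V) x)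
    \<and> finite (complex_spectrum (C_op U V \<gamma> \<beta>) - {1})
    \<and> complex_spectrum (C_op U V \<gamma> \<beta>) - {1} \<noteq> {}
    \<and> has_optimal_linear_rate (C_op U V \<gamma> \<beta>) (orth_proj (U \<inter> V)) (Gamma_rate U V \<gamma> \<beta>)
    \<and> Gamma_rate U V \<gamma> \<beta> < 1"
proof -
  have lin: "linear (C_op U V \<gamma> \<beta>)"
    and conv: "\<And>x. (\<lambda>k. (C_op U V \<gamma> \<beta> ^^ k) x) \<longlonglongrightarrow> orth_proj (U \<inter> V) x"
    using linear_C_op C_op_converges assms by blast+
  \<comment> \<open>A vector of \<open>V\<close> outside \<open>U\<close> is moved by the projection, so the limit is not the identity
  and an eigenvalue other than 1 exists.\<close>
  obtain x where "x \<in> V" "x \<notin> U" using assms(3) by blast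
  then have x: "orth_proj (U \<inter> V) x \<noteq> x"
    using orth_proj_in[OF subspace_inter[OF assms(1,2)], of x] by auto
  show ?thesis
    using conv finite_complex_spectrum[OF lin conv] complex_spectrum_nonempty[OF lin conv x]
      optimal_rate_subdominant[OF lin conv x]
    by (simp add: Gamma_rate_def)
qed

end
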